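(* Let $f, h:\mathbb{N}\to\mathbb{N}$ be computable functions with $f(n) \geq n$ for all $n$. Then there exist a computable function $E(\cdot,\cdot)$ and a constant $d$ such that for every $n$: if $|x| = f(n)$ and $|a| = h(n)$, then $|E(x,a)| = n$; and if moreover $|x|=f(n)$ and $C(x) \geq n + d$, then for some string $a$ of length $h(n)$, $C(E(x,a)) \geq n - \frac{f(n)-n}{2^{h(n)}} - d$.
   Context: $C$ denotes plain Kolmogorov complexity: $C(\sigma)=\min\{|p|:\mathbb{U}(p)=\sigma\}$ for a fixed optimal machine $\mathbb{U}$.
   Formalization: As stated the claim fails if two different n share the same f(n) and h(n) (E(x,a) would need two lengths); the two-argument E is proved when (f(n),h(n)) determines n, and for all f, h a computable E that also receives n is given. *)

theory Defs
  imports Complex_Main "HOL-Library.Nat_Bijection"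
begin

type_synonym str = "bool list"

text \<open>Unary presentation of the partial recursive functions; several arguments are packed with
  the Cantor pairing \<^const>\<open>prod_encode\<close>. \<^const>\<open>None\<close> means divergence.\<close>

inductive partrec :: "(nat \<Rightarrow> nat option) \<Rightarrow> bool" where
  zero: "partrec (\<lambda>_. Some 0)"
| succ: "partrec (\<lambda>n. Some (Suc n))"
| left: "partrec (\<lambda>n. Some (fst (prod_decode n)))"
| right: "partrec (\<lambda>n. Some (snd (prod_decode n)))"
| pair: "partrec f \<Longrightarrow> partrec g \<Longrightarrow>
    partrec (\<lambda>n. Option.bind (f n) (\<lambda>a. Option.bind (g n) (\<lambda>b. Some (prod_encode (a, b)))))"
| comp: "partrec f \<Longrightarrow> partrec g \<Longrightarrow> partrec (\<lambda>n. Option.bind (g n) f)"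
| prec: "partrec f \<Longrightarrow> partrec g \<Longrightarrow>
    partrec (\<lambda>n. case prod_decode n of (a, m) \<Rightarrow>
      rec_nat (f a) (\<lambda>k r. Option.bind r (\<lambda>v. g (prod_encode (a, prod_encode (k, v))))) m)"
| mu: "partrec f \<Longrightarrow>
    partrec (\<lambda>a.
      if \<exists>n. f (prod_encode (a, n)) = Some 0 \<and> (\<forall>m<n. f (prod_encode (a, m)) \<noteq> None)
      then Some (LEAST n. f (prod_encode (a, n)) = Some 0)
      else None)"

text \<open>Bijective base-2 numeration, the usual identification of strings with numbers.\<close>

fun str_encode :: "str \<Rightarrow> nat" where
  "str_encode [] = 0"
| "str_encode (b # bs) = 2 * str_encode bs + (if b then 2 else 1)"

lemma bij_str_encode: "bij str_encode"
proof (rule bijI)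
  show "inj str_encode"
  proof (rule injI)
    fix x y assume "str_encode x = str_encode y"
    then show "x = y"
    proof (induction x arbitrary: y)
      case Nil
      then show ?case by (cases y) (auto split: if_splits)
    next
      case (Cons b bs)
      then obtain c cs where y: "y = c # cs" by (cases y) (auto split: if_splits)
      with Cons.prems have "b = c \<and> str_encode bs = str_encode cs"
        by (cases b; cases c; simp; presburger)
      with Cons.IH y show ?case by blast
    qed
  qed
  have "\<exists>x. str_encode x = n" for n
  proof (induction n rule: less_induct)
    case (less n)
    have "n = 0 \<or> (\<exists>m. n = 2 * m + 1) \<or> (\<exists>m. n = 2 * m + 2)"
      by presburger
    then consider "n = 0" | m where "n = 2 * m + 1" | m where "n = 2 * m + 2"
      by blast
    then show ?case
    proof cases
      case 1
      then show ?thesis by (intro exI[of _ "[]"]) simp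
    next
      case (2 m)
      then obtain x where "str_encode x = m" using less.IH[of m] by auto
      with 2 show ?thesis by (intro exI[of _ "False # x"]) simp
    next
      case (3 m)
      then obtain x where "str_encode x = m" using less.IH[of m] by auto
      with 3 show ?thesis by (intro exI[of _ "True # x"]) simp
    qed
  qed
  then show "surj str_encode" by (metis surj_def)
qed

definition computable_nat :: "(nat \<Rightarrow> nat) \<Rightarrow> bool" where
  "computable_nat f \<longleftrightarrow> partrec (\<lambda>n. Some (f n))"

definition computable_str2 :: "(str \<Rightarrow> str \<Rightarrow> str) \<Rightarrow> bool" where
  "computable_str2 E \<longleftrightarrow> (\<exists>F. partrec F \<and>
     (\<forall>x a. F (prod_encode (str_encode x, str_encode a)) = Some (str_encode (E x a))))"

definition computable_nat_str2 :: "(nat \<Rightarrow> str \<Rightarrow> str \<Rightarrow> str) \<Rightarrow> bool" where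
  "computable_nat_str2 E \<longleftrightarrow> (\<exists>F. partrec F \<and>
     (\<forall>n x a. F (prod_encode (n, prod_encode (str_encode x, str_encode a)))
        = Some (str_encode (E n x a))))"

definition machine :: "(str \<Rightarrow> str option) \<Rightarrow> bool" where
  "machine M \<longleftrightarrow> (\<exists>F. partrec F \<and> (\<forall>p. F (str_encode p) = map_option str_encode (M p)))"

definition optimal :: "(str \<Rightarrow> str option) \<Rightarrow> bool" where
  "optimal U \<longleftrightarrow> machine U \<and>
     (\<forall>M. machine M \<longrightarrow> (\<exists>c. \<forall>p \<sigma>. M p = Some \<sigma> \<longrightarrow>
        (\<exists>q. U q = Some \<sigma> \<and> length q \<le> length p + c)))"

text \<open>For optimal \<open>U\<close> the set of lengths is nonempty, so the infimum is a minimum.\<close>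

definition plain_C :: "(str \<Rightarrow> str option) \<Rightarrow> str \<Rightarrow> nat" where
  "plain_C U \<sigma> = Inf {length p | p. U p = Some \<sigma>}"

end

theory Submission
  imports Defs "HOL-Library.FuncSet"
begin

text \<open>
  A counting argument shows that for every \<open>n\<close> there is a map
  \<open>E\<close> from strings of lengths \<open>f n\<close> and \<open>h n\<close> to strings of length \<open>n\<close> such that for every set \<open>S\<close> of
  at most \<open>2 ^ k\<close> strings, where \<open>k \<le> n - (f n - n) / 2 ^ h n - 3\<close>, fewer than \<open>2 ^ n\<close> strings \<open>x\<close> satisfy
  \<open>E x a \<in> S\<close> for all \<open>a\<close>. This property is decidable, so the first such \<open>E\<close> can be computed from \<open>n\<close>.
  Let \<open>S\<close> be the set of strings of length \<open>n\<close> whose complexity is too small. The strings \<open>x\<close> all of whose images lie in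
  \<open>S\<close> can be enumerated given \<open>n\<close>, because \<open>S\<close> can, and there are fewer than \<open>2 ^ n\<close> of them.
  Each is thus described by its rank in the enumeration, written with exactly \<open>n\<close> bits, so its
  complexity is at most \<open>n + O(1)\<close>.
\<close>

section \<open>Computable functions and decidable predicates\<close>

definition pfst :: "nat \<Rightarrow> nat" where "pfst n = fst (prod_decode n)"
definition psnd :: "nat \<Rightarrow> nat" where "psnd n = snd (prod_decode n)"

lemma pfst_prod_encode [simp]: "pfst (prod_encode (a, b)) = a"
  and psnd_prod_encode [simp]: "psnd (prod_encode (a, b)) = b"
  by (simp_all add: pfst_def psnd_def)

definition decidable :: "(nat \<Rightarrow> bool) \<Rightarrow> bool" where
  "decidable P \<longleftrightarrow> computable_nat (\<lambda>n. of_bool (P n))"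

lemma computable_id: "computable_nat (\<lambda>n. n)"
proof -
  have "partrec (\<lambda>n. Some (prod_encode (fst (prod_decode n), snd (prod_decode n))))"
    using partrec.pair[OF partrec.left partrec.right] by simp
  then show ?thesis by (simp add: computable_nat_def)
qed

lemma computable_comp:
  "computable_nat g \<Longrightarrow> computable_nat f \<Longrightarrow> computable_nat (\<lambda>n. g (f n))"
  unfolding computable_nat_def using partrec.comp[of "\<lambda>n. Some (g n)" "\<lambda>n. Some (f n)"] by simp

lemma computable_Suc: "computable_nat f \<Longrightarrow> computable_nat (\<lambda>n. Suc (f n))"
  by (rule computable_comp[of Suc]) (simp_all add: computable_nat_def partrec.succ)

lemma computable_pfst: "computable_nat f \<Longrightarrow> computable_nat (\<lambda>n. pfst (f n))"
  by (rule computable_comp[of pfst]) (simp_all add: computable_nat_def pfst_def partrec.left)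

lemma computable_psnd: "computable_nat f \<Longrightarrow> computable_nat (\<lambda>n. psnd (f n))"
  by (rule computable_comp[of psnd]) (simp_all add: computable_nat_def psnd_def partrec.right)

lemma computable_const: "computable_nat (\<lambda>n. c)"
proof (induction c)
  case 0
  show ?case by (simp add: computable_nat_def partrec.zero)
next
  case (Suc c)
  then show ?case by (rule computable_Suc)
qed

lemma computable_prod_encode:
  "computable_nat f \<Longrightarrow> computable_nat g \<Longrightarrow> computable_nat (\<lambda>n. prod_encode (f n, g n))"
  unfolding computable_nat_def
  using partrec.pair[of "\<lambda>n. Some (f n)" "\<lambda>n. Some (g n)"] by simp

text \<open>Keeping the parameter \<open>e\<close> visible in the recursion step lets the arithmetic
  functions below be written as \<open>rec_nat\<close> terms. Base and step are total, so the
  option-valued recursion only ever produces \<open>Some\<close>.\<close>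

lemma computable_rec_nat:
  assumes "computable_nat b" "computable_nat f"
    and "computable_nat (\<lambda>p. g (pfst p) (pfst (psnd p)) (psnd (psnd p)))"
  shows "computable_nat (\<lambda>e. rec_nat (f e) (\<lambda>k v. g e k v) (b e))"
proof -
  let ?g = "\<lambda>p. g (pfst p) (pfst (psnd p)) (psnd (psnd p))"
  have eq: "rec_nat (Some (f a)) (\<lambda>k r. Option.bind r
      (\<lambda>v. Some (?g (prod_encode (a, prod_encode (k, v)))))) m
    = Some (rec_nat (f a) (\<lambda>k v. g a k v) m)" for a m
    by (induction m) simp_all
  have "computable_nat (\<lambda>n. rec_nat (f (pfst n)) (\<lambda>k v. g (pfst n) k v) (psnd n))"
    using partrec.prec[OF assms(2,3)[unfolded computable_nat_def]]
    unfolding eq computable_nat_def by (simp add: case_prod_beta pfst_def psnd_def)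
  from computable_comp[OF this computable_prod_encode[OF computable_id assms(1)]]
  show ?thesis by simp
qed

lemmas computable_basic = computable_id computable_const computable_Suc computable_pfst
  computable_psnd computable_prod_encode computable_rec_nat

section \<open>Closure under arithmetic, bounded sums and iteration\<close>

lemma computable_add:
  assumes "computable_nat f" "computable_nat g"
  shows "computable_nat (\<lambda>n. f n + g n)"
proof -
  have "a + b = rec_nat a (\<lambda>_ v. Suc v) b" for a b :: nat by (induction b) simp_all
  then show ?thesis by (simp only:) (intro computable_basic assms)
qed

lemma computable_mult:
  assumes "computable_nat f" "computable_nat g"
  shows "computable_nat (\<lambda>n. f n * g n)"
proof -
  have "a * b = rec_nat 0 (\<lambda>_ v. v + a) b" for a b :: nat by (induction b) simp_all
  then show ?thesis
    by (simp only:) (intro computable_basic computable_add computable_comp[OF assms(1)] assms)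
qed

lemma computable_power:
  assumes "computable_nat f" "computable_nat g"
  shows "computable_nat (\<lambda>n. f n ^ g n)"
proof -
  have "a ^ b = rec_nat 1 (\<lambda>_ v. a * v) b" for a b :: nat by (induction b) simp_all
  then show ?thesis
    by (simp only:) (intro computable_basic computable_mult computable_comp[OF assms(1)] assms)
qed

lemma computable_diff:
  assumes "computable_nat f" "computable_nat g"
  shows "computable_nat (\<lambda>n. f n - g n)"
proof -
  have pred: "a - 1 = rec_nat 0 (\<lambda>k _. k) a" for a :: nat by (cases a) simp_all
  have "a - b = rec_nat a (\<lambda>_ v. v - 1) b" for a b :: nat by (induction b) simp_all
  then show ?thesis
    by (simp only: pred) (intro computable_basic assms)
qed

lemma computable_sum:
  assumes "computable_nat b" "computable_nat (\<lambda>p. g (pfst p) (psnd p))"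
  shows "computable_nat (\<lambda>e. \<Sum>i<b e. g e i)"
proof -
  have "(\<Sum>i<m. g e i) = rec_nat 0 (\<lambda>k v. v + g e k) m" for e m
    by (induction m) simp_all
  moreover have "computable_nat (\<lambda>p. g (pfst p) (pfst (psnd p)))"
    using computable_comp[OF assms(2), of "\<lambda>p. prod_encode (pfst p, pfst (psnd p))"]
    by (simp add: computable_basic)
  ultimately show ?thesis
    by (simp only:) (intro computable_basic computable_add assms)
qed

lemma computable_funpow:
  assumes "computable_nat g" "computable_nat b" "computable_nat f"
  shows "computable_nat (\<lambda>e. (g ^^ b e) (f e))"
proof -
  have "(g ^^ m) a = rec_nat a (\<lambda>_ v. g v) m" for a m by (induction m) simp_all
  then show ?thesis
    by (simp only:) (intro computable_basic computable_comp[OF assms(1)] assms)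
qed

section \<open>Closure of decidable predicates\<close>

lemma decidable_le:
  assumes "computable_nat f" "computable_nat g"
  shows "decidable (\<lambda>n. f n \<le> g n)"
proof -
  have "of_bool (a \<le> b) = 1 - (a - b)" for a b :: nat by simp
  then show ?thesis unfolding decidable_def
    by (simp only:) (intro computable_basic computable_diff assms)
qed

lemma decidable_not:
  assumes "decidable P"
  shows "decidable (\<lambda>n. \<not> P n)"
proof -
  have "of_bool (\<not> Q) = 1 - (of_bool Q :: nat)" for Q by simp
  then show ?thesis using assms unfolding decidable_def
    by (simp only:) (intro computable_diff computable_const)
qed

lemma decidable_conj: "decidable P \<Longrightarrow> decidable Q \<Longrightarrow> decidable (\<lambda>n. P n \<and> Q n)"
  unfolding decidable_def of_bool_conj by (rule computable_mult)

lemma decidable_disj: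
  assumes "decidable P" "decidable Q"
  shows "decidable (\<lambda>n. P n \<or> Q n)"
proof -
  have "P n \<or> Q n \<longleftrightarrow> \<not> (\<not> P n \<and> \<not> Q n)" for n by blast
  then show ?thesis by (simp only:) (intro decidable_not decidable_conj assms)
qed

lemma decidable_imp: "decidable P \<Longrightarrow> decidable Q \<Longrightarrow> decidable (\<lambda>n. P n \<longrightarrow> Q n)"
  unfolding imp_conv_disj by (intro decidable_not decidable_disj)

lemma decidable_less:
  "computable_nat f \<Longrightarrow> computable_nat g \<Longrightarrow> decidable (\<lambda>n. f n < g n)"
  unfolding Suc_le_eq[symmetric] by (intro decidable_le computable_Suc)

lemma decidable_eq:
  assumes "computable_nat f" "computable_nat g"
  shows "decidable (\<lambda>n. f n = g n)"
proof -
  have "f n = g n \<longleftrightarrow> f n \<le> g n \<and> g n \<le> f n" for n by auto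
  then show ?thesis by (simp only:) (intro decidable_conj decidable_le assms)
qed

lemma computable_of_bool: "decidable P \<Longrightarrow> computable_nat (\<lambda>n. of_bool (P n))"
  by (simp add: decidable_def)

lemma decidable_ex_less:
  assumes "computable_nat b" "decidable (\<lambda>p. P (pfst p) (psnd p))"
  shows "decidable (\<lambda>e. \<exists>i<b e. P e i)"
proof -
  have "(\<exists>i<b e. P e i) \<longleftrightarrow> 1 \<le> (\<Sum>i<b e. of_bool (P e i) :: nat)" for e
  proof -
    have "(\<Sum>i<b e. of_bool (P e i) :: nat) = 0 \<longleftrightarrow> (\<forall>i<b e. \<not> P e i)" by auto
    then show ?thesis by (metis less_one linorder_not_less)
  qed
  then show ?thesis
    by (simp only:) (intro decidable_le computable_const computable_sum computable_of_bool assms)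
qed

lemma decidable_all_less:
  assumes "computable_nat b" "decidable (\<lambda>p. P (pfst p) (psnd p))"
  shows "decidable (\<lambda>e. \<forall>i<b e. P e i)"
proof -
  have "(\<forall>i<b e. P e i) \<longleftrightarrow> \<not> (\<exists>i<b e. \<not> P e i)" for e by blast
  then show ?thesis by (simp only:) (intro decidable_not decidable_ex_less assms)
qed

lemma computable_if:
  assumes "decidable P" "computable_nat f" "computable_nat g"
  shows "computable_nat (\<lambda>n. if P n then f n else g n)"
proof -
  have "(if P n then f n else g n) = of_bool (P n) * f n + of_bool (\<not> P n) * g n" for n by simp
  then show ?thesis
    by (simp only:)
      (intro computable_add computable_mult computable_of_bool decidable_not assms)
qed

text \<open>The operator \<open>mu\<close> looks for the value 0, hence the negation of
  \<open>P\<close>. The characteristic function is total, so the convergence condition on smaller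
  arguments always holds.\<close>

lemma partrec_search:
  assumes "decidable (\<lambda>p. P (pfst p) (psnd p))"
  shows "partrec (\<lambda>e. if \<exists>n. P e n then Some (LEAST n. P e n) else None)"
proof -
  have "partrec (\<lambda>p. Some (of_bool (\<not> P (pfst p) (psnd p))))"
    using decidable_not[OF assms] by (simp add: decidable_def computable_nat_def)
  from partrec.mu[OF this] show ?thesis
    by (simp cong: if_cong)
qed

lemma computable_Least:
  assumes "decidable (\<lambda>p. P (pfst p) (psnd p))" "\<And>e. \<exists>n. P e n"
  shows "computable_nat (\<lambda>e. LEAST n. P e n)"
  using partrec_search[OF assms(1)] assms(2) by (simp add: computable_nat_def)

lemma computable_div:
  assumes "computable_nat f" "computable_nat g" "\<And>n. g n > 0"
  shows "computable_nat (\<lambda>n. f n div g n)"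
proof -
  have "f n div g n = (LEAST q. f n < Suc q * g n)" for n
  proof (rule Least_equality[symmetric])
    show "f n < Suc (f n div g n) * g n" using dividend_less_div_times[OF assms(3), of "f n" n]
      by (simp add: add.commute)
    show "f n div g n \<le> q" if "f n < Suc q * g n" for q
      using that by (metis less_Suc_eq_le less_mult_imp_div_less)
  qed
  moreover have "\<exists>q. f n < Suc q * g n" for n
    using assms(3)[of n] by (intro exI[of _ "f n"]) (cases "g n"; simp)
  ultimately show ?thesis
    by (simp only:)
      (intro computable_Least decidable_less computable_mult computable_basic
        computable_comp[OF assms(1)] computable_comp[OF assms(2)])
qed

lemma computable_mod:
  assumes "computable_nat f" "computable_nat g" "\<And>n. g n > 0"
  shows "computable_nat (\<lambda>n. f n mod g n)"
  unfolding minus_div_mult_eq_mod[symmetric]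
  by (intro computable_diff computable_mult computable_div assms)

lemmas computable_intros = computable_basic computable_add computable_mult computable_power
  computable_diff computable_sum computable_of_bool computable_if
  decidable_le decidable_less decidable_eq decidable_not decidable_conj decidable_disj
  decidable_imp decidable_ex_less decidable_all_less

section \<open>Stage-wise simulation\<close>

text \<open>A value \<open>Suc y\<close> at stage \<open>t\<close> says that
  the computation has been seen to halt with result \<open>y\<close>, and \<open>0\<close> that it has not halted yet.\<close>

definition simulates :: "(nat \<Rightarrow> nat \<Rightarrow> nat) \<Rightarrow> (nat \<Rightarrow> nat option) \<Rightarrow> bool" where
  "simulates H F \<longleftrightarrow> computable_nat (\<lambda>p. H (pfst p) (psnd p)) \<and>
     (\<forall>x y. F x = Some y \<longleftrightarrow> (\<exists>t. H x t = Suc y)) \<and>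
     (\<forall>x y t t'. H x t = Suc y \<longrightarrow> t \<le> t' \<longrightarrow> H x t' = Suc y)"

lemma simulatesI:
  assumes "computable_nat (\<lambda>p. H (pfst p) (psnd p))"
    and "\<And>x y t t'. H x t = Suc y \<Longrightarrow> t \<le> t' \<Longrightarrow> H x t' = Suc y"
    and "\<And>x y t. H x t = Suc y \<Longrightarrow> F x = Some y"
    and "\<And>x y. F x = Some y \<Longrightarrow> \<exists>t. H x t = Suc y"
  shows "simulates H F"
  unfolding simulates_def by (intro conjI allI impI iffI; (elim exE)?) (fact assms)+

lemma simulates_computable:
  assumes "computable_nat f"
  shows "simulates (\<lambda>x t. Suc (f x)) (\<lambda>x. Some (f x))"
  by (rule simulatesI) (intro computable_intros computable_comp[OF assms], simp_all)

context
  fixes H F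
  assumes sim: "simulates H F"
begin

lemma simulates_apply:
  "computable_nat f \<Longrightarrow> computable_nat g \<Longrightarrow> computable_nat (\<lambda>n. H (f n) (g n))"
  using computable_comp[OF sim[unfolded simulates_def, THEN conjunct1] computable_prod_encode]
  by simp

lemma simulates_mono: "H x t = Suc y \<Longrightarrow> t \<le> t' \<Longrightarrow> H x t' = Suc y"
  by (rule sim[unfolded simulates_def, THEN conjunct2, THEN conjunct2, rule_format])

lemma simulates_iff: "F x = Some y \<longleftrightarrow> (\<exists>t. H x t = Suc y)"
  by (rule sim[unfolded simulates_def, THEN conjunct2, THEN conjunct1, rule_format])

lemma simulates_sound: "H x t = Suc y \<Longrightarrow> F x = Some y"
  unfolding simulates_iff by (rule exI)

lemma simulates_complete: "F x = Some y \<Longrightarrow> \<exists>t. H x t = Suc y"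
  by (simp add: simulates_iff)

text \<open>Monotonicity in the stage makes finitely many haltings simultaneous. This serves for the
  arguments below a root in minimisation and for all seeds \<open>a\<close> at once in the
  extractor.\<close>

lemma simulates_complete_uniform:
  assumes "finite A" "\<And>i. i \<in> A \<Longrightarrow> F (x i) = Some (y i)"
  shows "\<exists>t0. \<forall>t\<ge>t0. \<forall>i\<in>A. H (x i) t = Suc (y i)"
proof -
  have "\<forall>\<^sub>F t in sequentially. \<forall>i\<in>A. H (x i) t = Suc (y i)"
    using assms
    by (intro eventually_ball_finite ballI)
      (auto simp: eventually_sequentially dest!: assms(2) simulates_complete intro: simulates_mono)
  then show ?thesis by (simp add: eventually_sequentially)
qed

end

section \<open>Simulations for the constructors of partial recursive functions\<close>

lemma simulates_pair:
  assumes Hf: "simulates Hf f" and Hg: "simulates Hg g"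
  shows "\<exists>H. simulates H
    (\<lambda>n. Option.bind (f n) (\<lambda>a. Option.bind (g n) (\<lambda>b. Some (prod_encode (a, b)))))"
proof (rule exI[of _ "\<lambda>x t. if Hf x t = 0 \<or> Hg x t = 0 then 0
    else Suc (prod_encode (Hf x t - 1, Hg x t - 1))"], rule simulatesI)
  let ?H = "\<lambda>x t. if Hf x t = 0 \<or> Hg x t = 0 then 0
    else Suc (prod_encode (Hf x t - 1, Hg x t - 1))"
  show "computable_nat (\<lambda>p. ?H (pfst p) (psnd p))"
    by (intro computable_intros simulates_apply[OF Hf] simulates_apply[OF Hg])
  fix x y
  {
    fix t assume "?H x t = Suc y"
    then obtain a b where ab: "Hf x t = Suc a" "Hg x t = Suc b" "y = prod_encode (a, b)"
      by (cases "Hf x t"; cases "Hg x t") auto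
    then show "Option.bind (f x) (\<lambda>a. Option.bind (g x) (\<lambda>b. Some (prod_encode (a, b)))) = Some y"
      using simulates_sound[OF Hf] simulates_sound[OF Hg] by simp
    show "?H x t' = Suc y" if "t \<le> t'" for t'
      using ab simulates_mono[OF Hf _ that] simulates_mono[OF Hg _ that] by simp
  }
  assume "Option.bind (f x) (\<lambda>a. Option.bind (g x) (\<lambda>b. Some (prod_encode (a, b)))) = Some y"
  then obtain a b where ab: "f x = Some a" "g x = Some b" "y = prod_encode (a, b)"
    by (auto simp: bind_eq_Some_conv)
  obtain s where "Hf x s = Suc a" using simulates_complete[OF Hf ab(1)] ..
  moreover obtain t where "Hg x t = Suc b" using simulates_complete[OF Hg ab(2)] ..
  ultimately have "Hf x (max s t) = Suc a" "Hg x (max s t) = Suc b"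
    using simulates_mono[OF Hf _ max.cobounded1] simulates_mono[OF Hg _ max.cobounded2] by blast+
  then show "\<exists>t. ?H x t = Suc y" using ab by (intro exI[of _ "max s t"]) simp
qed

lemma simulates_comp:
  assumes Hf: "simulates Hf f" and Hg: "simulates Hg g"
  shows "\<exists>H. simulates H (\<lambda>n. Option.bind (g n) f)"
proof (rule exI[of _ "\<lambda>x t. if Hg x t = 0 then 0 else Hf (Hg x t - 1) t"], rule simulatesI)
  let ?H = "\<lambda>x t. if Hg x t = 0 then 0 else Hf (Hg x t - 1) t"
  show "computable_nat (\<lambda>p. ?H (pfst p) (psnd p))"
    by (intro computable_intros simulates_apply[OF Hf] simulates_apply[OF Hg])
  fix x y
  {
    fix t assume "?H x t = Suc y"
    then obtain a where a: "Hg x t = Suc a" "Hf a t = Suc y"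
      by (cases "Hg x t") auto
    then show "Option.bind (g x) f = Some y"
      using simulates_sound[OF Hf] simulates_sound[OF Hg] by simp
    show "?H x t' = Suc y" if "t \<le> t'" for t'
      using a simulates_mono[OF Hf _ that] simulates_mono[OF Hg _ that] by simp
  }
  assume "Option.bind (g x) f = Some y"
  then obtain a where a: "g x = Some a" "f a = Some y"
    by (auto simp: bind_eq_Some_conv)
  obtain s where "Hg x s = Suc a" using simulates_complete[OF Hg a(1)] ..
  moreover obtain t where "Hf a t = Suc y" using simulates_complete[OF Hf a(2)] ..
  ultimately have "Hg x (max s t) = Suc a" "Hf a (max s t) = Suc y"
    using simulates_mono[OF Hg _ max.cobounded1] simulates_mono[OF Hf _ max.cobounded2] by blast+
  then show "\<exists>t. ?H x t = Suc y" by (intro exI[of _ "max s t"]) simp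
qed

text \<open>All steps of the recursion run with the same stage bound \<open>t\<close>; a step that
  has not halted leaves 0, and the 0 is passed on through the remaining steps.\<close>

lemma simulates_prec:
  assumes Hf: "simulates Hf f" and Hg: "simulates Hg g"
  shows "\<exists>H. simulates H (\<lambda>n. case prod_decode n of (a, m) \<Rightarrow>
      rec_nat (f a) (\<lambda>k r. Option.bind r (\<lambda>v. g (prod_encode (a, prod_encode (k, v))))) m)"
proof -
  define R where "R a = rec_nat (f a)
    (\<lambda>k r. Option.bind r (\<lambda>v. g (prod_encode (a, prod_encode (k, v)))))" for a
  define h where "h a t = rec_nat (Hf a t)
    (\<lambda>k v. if v = 0 then 0 else Hg (prod_encode (a, prod_encode (k, v - 1))) t)" for a t
  have R: "R a 0 = f a"
    "R a (Suc m) = Option.bind (R a m) (\<lambda>v. g (prod_encode (a, prod_encode (m, v))))" for a m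
    by (simp_all add: R_def)
  have h: "h a t 0 = Hf a t" "h a t (Suc m) = (if h a t m = 0 then 0
      else Hg (prod_encode (a, prod_encode (m, h a t m - 1))) t)" for a t m
    by (simp_all add: h_def)
  have Suc_cases: "\<exists>v. h a t m = Suc v \<and> Hg (prod_encode (a, prod_encode (m, v))) t = Suc y"
    if "h a t (Suc m) = Suc y" for a t m y
    using that by (cases "h a t m") (simp_all add: h)
  have mono: "h a t m = Suc y \<Longrightarrow> t \<le> t' \<Longrightarrow> h a t' m = Suc y" for a t t' m y
  proof (induction m arbitrary: y)
    case 0
    then show ?case unfolding h by (rule simulates_mono[OF Hf])
  next
    case (Suc m)
    from Suc_cases[OF Suc.prems(1)] obtain v where v: "h a t m = Suc v"
      "Hg (prod_encode (a, prod_encode (m, v))) t = Suc y" by blast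
    show ?case using Suc.IH[OF v(1) Suc.prems(2)] simulates_mono[OF Hg v(2) Suc.prems(2)]
      by (simp add: h)
  qed
  have sound: "h a t m = Suc y \<Longrightarrow> R a m = Some y" for a t m y
  proof (induction m arbitrary: y)
    case 0
    then show ?case using simulates_sound[OF Hf] by (simp add: h R)
  next
    case (Suc m)
    from Suc_cases[OF Suc.prems(1)] obtain v where v: "h a t m = Suc v"
      "Hg (prod_encode (a, prod_encode (m, v))) t = Suc y" by blast
    show ?case using Suc.IH[OF v(1)] simulates_sound[OF Hg v(2)] by (simp add: R)
  qed
  have complete: "R a m = Some y \<Longrightarrow> \<exists>t. h a t m = Suc y" for a m y
  proof (induction m arbitrary: y)
    case 0
    then show ?case using simulates_complete[OF Hf] by (simp add: h R)
  next
    case (Suc m)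
    then obtain v where v: "R a m = Some v" "g (prod_encode (a, prod_encode (m, v))) = Some y"
      by (auto simp: R bind_eq_Some_conv)
    obtain s where "h a s m = Suc v" using Suc.IH[OF v(1)] ..
    moreover obtain t where "Hg (prod_encode (a, prod_encode (m, v))) t = Suc y"
      using simulates_complete[OF Hg v(2)] ..
    ultimately have "h a (max s t) m = Suc v"
      "Hg (prod_encode (a, prod_encode (m, v))) (max s t) = Suc y"
      using mono[OF _ max.cobounded1] simulates_mono[OF Hg _ max.cobounded2] by blast+
    then show ?case by (intro exI[of _ "max s t"]) (simp add: h)
  qed
  have "simulates (\<lambda>n t. h (pfst n) t (psnd n)) (\<lambda>n. R (pfst n) (psnd n))"
  proof (rule simulatesI)
    show "computable_nat (\<lambda>p. h (pfst (pfst p)) (psnd p) (psnd (pfst p)))"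
      unfolding h_def
      by (intro computable_intros simulates_apply[OF Hf] simulates_apply[OF Hg])
  qed (fact mono sound complete)+
  then show ?thesis by (auto simp: R_def pfst_def psnd_def case_prod_beta)
qed

lemma simulates_mu:
  assumes Hf: "simulates Hf f"
  shows "\<exists>H. simulates H (\<lambda>a.
      if \<exists>n. f (prod_encode (a, n)) = Some 0 \<and> (\<forall>m<n. f (prod_encode (a, m)) \<noteq> None)
      then Some (LEAST n. f (prod_encode (a, n)) = Some 0)
      else None)"
proof -
  \<comment> \<open>The first argument not yet seen to have a nonzero value: a simulated value at
    most 1 means still running (0) or root found (1). The alternative \<open>t \<le> n\<close> makes
    the search total. An argument still running blocks the answer, because minimisation requires all
    smaller arguments to converge.\<close>
  define N where "N a t = (LEAST n. t \<le> n \<or> Hf (prod_encode (a, n)) t \<le> 1)" for a t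
  define H where "H a t =
    (if N a t < t \<and> Hf (prod_encode (a, N a t)) t = 1 then Suc (N a t) else 0)" for a t
  let ?F = "\<lambda>a. if \<exists>n. f (prod_encode (a, n)) = Some 0 \<and> (\<forall>m<n. f (prod_encode (a, m)) \<noteq> None)
      then Some (LEAST n. f (prod_encode (a, n)) = Some 0) else None"
  have H_iff: "H a t = Suc n \<longleftrightarrow> n < t \<and> Hf (prod_encode (a, n)) t = 1 \<and>
      (\<forall>m<n. 1 < Hf (prod_encode (a, m)) t)" (is "_ \<longleftrightarrow> ?r") for a t n
  proof
    assume "H a t = Suc n"
    then have n: "n = N a t" "n < t" "Hf (prod_encode (a, n)) t = 1"
      by (auto simp: H_def split: if_splits)
    then show ?r
      using not_less_Least[of _ "\<lambda>n. t \<le> n \<or> Hf (prod_encode (a, n)) t \<le> 1", folded N_def]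
      by (auto simp: not_le)
  next
    assume r: ?r
    have "N a t = n" unfolding N_def
    proof (rule Least_equality)
      show "n \<le> m" if "t \<le> m \<or> Hf (prod_encode (a, m)) t \<le> 1" for m
        using r that by (metis le_trans less_imp_le not_le)
    qed (use r in simp)
    with r show "H a t = Suc n" by (simp add: H_def)
  qed
  \<comment> \<open>The \<open>LEAST\<close> ranges over all roots, but the convergent prefix up to
    some root \<open>k\<close> forces the least root to lie at or below \<open>k\<close>, so
    everything before it converges to a nonzero value.\<close>
  have F_iff: "?F a = Some n \<longleftrightarrow> f (prod_encode (a, n)) = Some 0 \<and>
      (\<forall>m<n. \<exists>v. f (prod_encode (a, m)) = Some (Suc v))" (is "_ \<longleftrightarrow> ?r") for a n
  proof
    assume l: "?F a = Some n"
    then obtain k where k: "f (prod_encode (a, k)) = Some 0"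
        "\<forall>m<k. f (prod_encode (a, m)) \<noteq> None"
      and n: "n = (LEAST n. f (prod_encode (a, n)) = Some 0)"
      by (auto split: if_splits)
    have "f (prod_encode (a, n)) = Some 0" unfolding n by (rule LeastI[of _ k]) (fact k)
    moreover have "\<exists>v. f (prod_encode (a, m)) = Some (Suc v)" if "m < n" for m
    proof -
      have "m < k" using that Least_le[of "\<lambda>n. f (prod_encode (a, n)) = Some 0", OF k(1)] n
        by simp
      moreover have "f (prod_encode (a, m)) \<noteq> Some 0" using that not_less_Least unfolding n by blast
      ultimately show ?thesis using k(2) by (metis not0_implies_Suc option.exhaust)
    qed
    ultimately show ?r by blast
  next
    assume r: ?r
    have "(LEAST n. f (prod_encode (a, n)) = Some 0) = n"
      using r by (intro Least_equality) (auto simp: not_less[symmetric])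
    with r show "?F a = Some n" by fastforce
  qed
  have "simulates H ?F"
  proof (rule simulatesI)
    have N: "computable_nat (\<lambda>p. N (pfst p) (psnd p))" unfolding N_def
      by (intro computable_Least computable_intros simulates_apply[OF Hf]) blast
    show "computable_nat (\<lambda>p. H (pfst p) (psnd p))" unfolding H_def
      by (intro computable_intros simulates_apply[OF Hf] N)
  next
    fix a n t t' assume a: "H a t = Suc n" "t \<le> t'"
    have "Hf (prod_encode (a, m)) t' = Hf (prod_encode (a, m)) t"
      if "Hf (prod_encode (a, m)) t \<noteq> 0" for m
      using that simulates_mono[OF Hf _ a(2)] by (metis not0_implies_Suc)
    with a show "H a t' = Suc n" unfolding H_iff by auto
  next
    fix a n t assume "H a t = Suc n"
    moreover have "\<exists>v. f (prod_encode (a, m)) = Some (Suc v)"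
      if "1 < Hf (prod_encode (a, m)) t" for m
      using that simulates_sound[OF Hf]
      by (metis One_nat_def less_nat_zero_code less_numeral_extra(4) not0_implies_Suc)
    ultimately show "?F a = Some n"
      unfolding H_iff F_iff using simulates_sound[OF Hf, of _ t 0] by auto
  next
    fix a n assume "?F a = Some n"
    then have r: "f (prod_encode (a, n)) = Some 0"
      "\<forall>m<n. \<exists>v. f (prod_encode (a, m)) = Some (Suc v)" unfolding F_iff by auto
    from r(2) obtain v where v: "\<And>m. m < n \<Longrightarrow> f (prod_encode (a, m)) = Some (Suc (v m))"
      by metis
    obtain s where s: "\<forall>t\<ge>s. \<forall>m\<in>{..<n}. Hf (prod_encode (a, m)) t = Suc (Suc (v m))"
      using simulates_complete_uniform[OF Hf, of "{..<n}" "\<lambda>m. prod_encode (a, m)"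
          "\<lambda>m. Suc (v m)"] v by auto
    obtain t where "Hf (prod_encode (a, n)) t = Suc 0" using simulates_complete[OF Hf r(1)] ..
    \<comment> \<open>The summand \<open>Suc n\<close> makes the stage exceed \<open>n\<close>, as
      the cutoff in \<open>N\<close> demands.\<close>
    then have "Hf (prod_encode (a, n)) (s + t + Suc n) = Suc 0"
      by (rule simulates_mono[OF Hf]) simp
    then have "H a (s + t + Suc n) = Suc n" using s unfolding H_iff by auto
    then show "\<exists>t. H a t = Suc n" ..
  qed
  then show ?thesis by (rule exI[of _ H])
qed

text \<open>Halting thereby becomes the limit of a decidable relation monotone in the stage, which
  is what makes the strings of low complexity enumerable.\<close>

lemma partrec_simulates: "partrec F \<Longrightarrow> \<exists>H. simulates H F"
proof (induction rule: partrec.induct)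
  case zero
  show ?case using simulates_computable[OF computable_const] by blast
next
  case succ
  show ?case using simulates_computable[OF computable_Suc[OF computable_id]] by blast
next
  case left
  show ?case using simulates_computable[OF computable_pfst[OF computable_id]]
    by (auto simp: pfst_def)
next
  case right
  show ?case using simulates_computable[OF computable_psnd[OF computable_id]]
    by (auto simp: psnd_def)
next
  case (pair f g)
  then show ?case using simulates_pair by blast
next
  case (comp f g)
  then show ?case using simulates_comp by blast
next
  case (prec f g)
  then show ?case using simulates_prec by blast
next
  case (mu f)
  then show ?case using simulates_mu by blast
qed

section \<open>Dispersers\<close>

text \<open>The quotient \<open>t ^ t / fact t\<close> is a single term of the exponential series at
  \<open>t\<close>, and \<open>exp 1\<close> is at most 3.\<close>

lemma self_power_le_fact: "t ^ t \<le> 3 ^ t * (fact t :: nat)"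
proof -
  have "real t ^ t / fact t \<le> (\<Sum>k\<le>t. real t ^ k / fact k)"
    by (rule member_le_sum) auto
  also have "\<dots> \<le> (\<Sum>k. real t ^ k / fact k)"
    using summable_exp[of "real t"]
    by (intro sum_le_suminf) (auto simp: divide_inverse mult.commute)
  also have "\<dots> = exp (real t)"
    by (simp add: exp_def scaleR_conv_of_real divide_inverse mult.commute)
  also have "\<dots> = exp 1 ^ t" by (simp flip: exp_of_nat_mult)
  also have "\<dots> \<le> 3 ^ t" using exp_le by (intro power_mono) auto
  finally have "real (t ^ t) \<le> real (3 ^ t * fact t)" by (simp add: field_simps)
  then show ?thesis by (simp only: of_nat_le_iff)
qed

text \<open>Bound the binomial coefficient by \<open>(m * t) ^ t / fact t\<close> and use
  \<open>fact t \<ge> t ^ t / 3 ^ t\<close>.\<close>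

lemma choose_le_power:
  fixes t m :: nat
  assumes "t > 0"
  shows "(m * t) choose t \<le> (3 * m) ^ t"
proof -
  have "((m * t) choose t) * t ^ t \<le> ((m * t) choose t) * (3 ^ t * fact t)"
    by (rule mult_left_mono[OF self_power_le_fact]) simp
  also have "\<dots> = 3 ^ t * (((m * t) choose t) * fact t)" by simp
  also have "\<dots> \<le> 3 ^ t * (m * t) ^ t"
    by (intro mult_left_mono binomial_fact_pow) simp
  also have "\<dots> = (3 * m) ^ t * t ^ t" by (simp add: power_mult_distrib)
  finally show ?thesis using assms by simp
qed

text \<open>The probabilistic method: a uniformly random \<open>g\<close> maps a given \<open>T\<close> of size \<open>2 ^ n\<close> into a given
  small \<open>S\<close> with such a small probability that the union bound over all \<open>S\<close> and \<open>T\<close> is below 1.\<close>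

lemma disperser_exists:
  fixes X :: "'a set" and A :: "'b set" and n l :: nat
  assumes X: "card X = 2 ^ l" and A: "finite A" "A \<noteq> {}" and nl: "n \<le> l"
  shows "\<exists>g :: 'a \<Rightarrow> 'b \<Rightarrow> nat. (\<forall>x\<in>X. \<forall>a\<in>A. g x a < 2 ^ n) \<and>
    (\<forall>S K. S \<subseteq> {..<2 ^ n} \<longrightarrow> card S \<le> 2 ^ K \<longrightarrow>
      K * card A + (l - n) + 3 * card A \<le> n * card A \<longrightarrow>
      card {x\<in>X. \<forall>a\<in>A. g x a \<in> S} < 2 ^ n)"
proof -
  define D t Y where "D = card A" and "t = (2 ^ n :: nat)" and "Y = {..<t}"
  \<comment> \<open>Each bad event will have probability at most \<open>1 / q\<close>, and there
    will be fewer than \<open>q\<close> of them.\<close>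
  define q :: nat where "q = (2 ^ (l - n) * 8 ^ D) ^ t"
  define small where "small = {S. S \<subseteq> Y \<and>
    (\<exists>K. card S \<le> 2 ^ K \<and> K * D + (l - n) + 3 * D \<le> n * D)}"
  define sub where "sub = {T. T \<subseteq> X \<and> card T = t}"
  \<comment> \<open>The bad event that every \<open>x\<close> in \<open>T\<close> has all its images
    in \<open>S\<close>.\<close>
  define into where
    "into = (\<lambda>(S, T). PiE (X \<times> A) (\<lambda>(x, a). if x \<in> T then S else Y))"
  have D: "D > 0" using A by (simp add: D_def card_gt_0_iff)
  have t: "t > 0" by (simp add: t_def)
  have finX: "finite X" using X by (metis card.infinite power_not_zero zero_neq_numeral)
  have Xt: "2 ^ l = 2 ^ (l - n) * t"
    unfolding t_def using nl by (simp flip: power_add)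
  have card_into: "card (into (S, T)) * q \<le> card (PiE (X \<times> A) (\<lambda>_. Y))"
    if S: "S \<in> small" and T: "T \<in> sub" for S T
  proof -
    obtain K where K: "card S \<le> 2 ^ K" "K * D + (l - n) + 3 * D \<le> n * D"
      using S by (auto simp: small_def)
    have T': "T \<subseteq> X" "card T = t" using T by (auto simp: sub_def)
    have split: "card (PiE (X \<times> A) (\<lambda>(x, a). if x \<in> T then S' else Y))
        = (card S' ^ D) ^ t * (card Y ^ D) ^ card (X - T)" for S' :: "nat set"
    proof -
      have "card (PiE (X \<times> A) (\<lambda>(x, a). if x \<in> T then S' else Y))
        = (\<Prod>x\<in>X. \<Prod>a\<in>A. card (if x \<in> T then S' else Y))"
        using finX A(1)
        by (subst card_PiE)
          (simp_all add: prod.cartesian_product case_prod_beta del: prod_constant)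
      also have "\<dots> = (\<Prod>x\<in>X. if x \<in> T then card S' ^ D else card Y ^ D)"
        by (intro prod.cong) (auto simp: D_def)
      also have "\<dots> = (card S' ^ D) ^ card T * (card Y ^ D) ^ card (X - T)"
        using finX T'(1) by (simp add: prod.If_cases Int_absorb1 Diff_eq)
      finally show ?thesis by (simp add: T'(2))
    qed
    \<comment> \<open>For one \<open>x\<close> the chance that all \<open>D\<close> images fall into
      \<open>S\<close> is at most \<open>1 / (2 ^ (l - n) * 8 ^ D)\<close>; independence over the
      \<open>t\<close> elements of \<open>T\<close> gives \<open>q\<close>.\<close>
    have "card S ^ D * (2 ^ (l - n) * 8 ^ D) \<le> (2 ^ K) ^ D * (2 ^ (l - n) * 8 ^ D)"
      using K(1) by (intro mult_right_mono power_mono) auto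
    also have "\<dots> = 2 ^ (K * D + (l - n) + 3 * D)"
      by (simp add: power_add power_mult)
    also have "\<dots> \<le> 2 ^ (n * D)" using K(2) by (intro power_increasing) auto
    also have "\<dots> = card Y ^ D" by (simp add: Y_def t_def power_mult)
    finally have "(card S ^ D * (2 ^ (l - n) * 8 ^ D)) ^ t \<le> (card Y ^ D) ^ t"
      by (rule power_mono) simp
    then have "(card S ^ D) ^ t * q \<le> (card Y ^ D) ^ t"
      by (simp add: q_def power_mult_distrib)
    then have "(card S ^ D) ^ t * (card Y ^ D) ^ card (X - T) * q
        \<le> (card Y ^ D) ^ t * (card Y ^ D) ^ card (X - T)"
      by (metis mult.commute mult.left_commute mult_le_mono2)
    moreover have "(\<lambda>(x, a). if x \<in> T then Y else Y) = (\<lambda>_ :: 'a \<times> 'b. Y)" by auto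
    ultimately show ?thesis using split[of S] split[of Y] by (simp add: into_def)
  qed
  have fin: "finite small" "finite sub"
    using finX by (auto simp: small_def sub_def Y_def)
  have "card (small \<times> sub) \<le> 2 ^ t * ((2 ^ (l - n) * t) choose t)"
  proof -
    have "card small \<le> card (Pow Y)" by (intro card_mono) (auto simp: small_def Y_def)
    moreover have "card sub = (2 ^ (l - n) * t) choose t"
      unfolding sub_def using n_subsets[OF finX, of t] by (simp add: X Xt)
    ultimately show ?thesis by (simp add: card_cartesian_product card_Pow Y_def)
  qed
  also have "\<dots> \<le> 2 ^ t * (3 * 2 ^ (l - n)) ^ t"
    using choose_le_power[OF t, of "2 ^ (l - n)"] by simp
  also have "\<dots> = (6 * 2 ^ (l - n)) ^ t" by (subst power_mult_distrib[symmetric]) simp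
  \<comment> \<open>The 6 is the product of 2 and 3 from counting \<open>S\<close> and
    \<open>T\<close>; the 8 comes from the term \<open>3 * card A\<close> of the hypothesis, and
    \<open>D > 0\<close> makes the inequality strict.\<close>
  also have "\<dots> < (8 ^ D * 2 ^ (l - n)) ^ t"
  proof (rule power_strict_mono)
    have "(6 :: nat) < 8 ^ 1" by simp
    also have "\<dots> \<le> 8 ^ D" using D by (intro power_increasing) auto
    finally show "6 * 2 ^ (l - n) < (8 ^ D * 2 ^ (l - n) :: nat)" by simp
  qed (use t in auto)
  finally have few: "card (small \<times> sub) < q" by (simp add: q_def mult.commute)
  have "card (\<Union>p\<in>small \<times> sub. into p) * q \<le> (\<Sum>p\<in>small \<times> sub. card (into p)) * q"
    using fin by (intro mult_right_mono card_UN_le) auto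
  also have "\<dots> \<le> card (small \<times> sub) * card (PiE (X \<times> A) (\<lambda>_. Y))"
    unfolding sum_distrib_right using card_into by (intro sum_bounded_above[THEN order_trans]) auto
  also have "\<dots> < q * card (PiE (X \<times> A) (\<lambda>_. Y))"
    using few t finX A by (simp add: card_PiE Y_def)
  finally have "card (\<Union>p\<in>small \<times> sub. into p) < card (PiE (X \<times> A) (\<lambda>_. Y))"
    by (simp add: mult.commute)
  moreover have "finite (\<Union>p\<in>small \<times> sub. into p)"
    using fin finX A unfolding into_def
    by (auto intro!: finite_PiE simp: Y_def small_def dest: finite_subset split: if_splits)
  ultimately have "\<not> PiE (X \<times> A) (\<lambda>_. Y) \<subseteq> (\<Union>p\<in>small \<times> sub. into p)"
    using card_mono leD by blast
  then obtain g where g: "g \<in> PiE (X \<times> A) (\<lambda>_. Y)"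
    and "g \<notin> (\<Union>p\<in>small \<times> sub. into p)" by blast
  then have g': "\<And>S T. S \<in> small \<Longrightarrow> T \<in> sub \<Longrightarrow> g \<notin> into (S, T)" by blast
  have "card {x\<in>X. \<forall>a\<in>A. g (x, a) \<in> S} < t" if S: "S \<in> small" for S
  \<comment> \<open>If \<open>t\<close> or more elements had all images in \<open>S\<close>, some
    \<open>T\<close> of exactly \<open>t\<close> of them would put \<open>g\<close> in a bad
    event.\<close>
  proof (rule ccontr)
    assume "\<not> ?thesis"
    then obtain T where T: "T \<subseteq> {x\<in>X. \<forall>a\<in>A. g (x, a) \<in> S}" "card T = t"
      using obtain_subset_with_card_n[of t "{x\<in>X. \<forall>a\<in>A. g (x, a) \<in> S}"] not_less by blast
    then have "T \<in> sub" by (auto simp: sub_def)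
    moreover have "g \<in> into (S, T)"
      using g T(1) by (auto simp: into_def PiE_iff)
    ultimately show False using g' S by blast
  qed
  then show ?thesis using g
    by (intro exI[of _ "\<lambda>x a. g (x, a)"])
      (auto simp: small_def Y_def t_def D_def PiE_iff)
qed

section \<open>Strings and their codes\<close>

text \<open>In bijective base 2 the strings of length \<open>l\<close> have consecutive codes;
  counting from 0, the \<open>v\<close>-th of them is \<open>2 ^ l - 1 + v\<close>.\<close>

definition codes :: "nat \<Rightarrow> nat set" where
  "codes l = {c. 2 ^ l \<le> Suc c \<and> Suc c < 2 ^ Suc l}"

text \<open>The integer part of the binary logarithm of \<open>Suc c\<close>, written as a search so
  that it is visibly computable.\<close>

definition code_length :: "nat \<Rightarrow> nat" where
  "code_length c = (LEAST l. Suc c < 2 ^ Suc l)"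

definition str_decode :: "nat \<Rightarrow> str" where
  "str_decode = inv str_encode"

lemma str_encode_decode [simp]: "str_encode (str_decode c) = c"
  using bij_str_encode by (simp add: str_decode_def bij_is_surj surj_f_inv_f)

lemma str_decode_encode [simp]: "str_decode (str_encode x) = x"
  using bij_str_encode by (simp add: str_decode_def bij_is_inj)

lemma str_encode_in_codes: "str_encode x \<in> codes (length x)"
  by (induction x) (auto simp: codes_def)

lemma codes_eq_atLeastLessThan: "codes l = {2 ^ l - 1..<2 ^ Suc l - 1}"
  by (auto simp: codes_def)

lemma card_codes: "card (codes l) = 2 ^ l"
  by (simp add: codes_eq_atLeastLessThan)

lemma finite_codes: "finite (codes l)"
  by (simp add: codes_eq_atLeastLessThan)

lemma codes_less: "c \<in> codes l \<Longrightarrow> c < 2 ^ Suc l"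
  by (simp add: codes_def)

lemma codes_nonempty: "codes l \<noteq> {}"
  using card_codes[of l] by (metis card.empty power_not_zero zero_neq_numeral)

lemma codes_index: "v < 2 ^ l \<Longrightarrow> 2 ^ l - 1 + v \<in> codes l"
  by (simp add: codes_def)

lemma code_length_eq: "c \<in> codes l \<Longrightarrow> code_length c = l"
  unfolding code_length_def codes_def
proof (rule Least_equality)
  fix k assume "c \<in> {c. 2 ^ l \<le> Suc c \<and> Suc c < 2 ^ Suc l}" "Suc c < 2 ^ Suc k"
  then have "(2 :: nat) ^ l < 2 ^ Suc k" by simp
  then have "l < Suc k" by (rule power_less_imp_less_exp[rotated]) simp
  then show "l \<le> k" by simp
qed simp

lemma code_length_encode [simp]: "code_length (str_encode x) = length x"
  by (rule code_length_eq[OF str_encode_in_codes])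

lemma in_codes_iff: "c \<in> codes l \<longleftrightarrow> code_length c = l"
  by (metis code_length_eq code_length_encode str_encode_decode str_encode_in_codes)

lemma length_str_decode [simp]: "length (str_decode c) = code_length c"
  by (metis code_length_encode str_encode_decode)

lemma computable_code_length:
  assumes "computable_nat f"
  shows "computable_nat (\<lambda>n. code_length (f n))"
proof -
  have "\<exists>l. Suc c < 2 ^ Suc l" for c :: nat
    using codes_less[OF str_encode_in_codes, of "str_decode c"]
    by (intro exI[of _ "Suc (code_length c)"]) simp
  then show ?thesis unfolding code_length_def
    by (intro computable_Least computable_intros computable_comp[OF assms])
qed

lemma decidable_in_codes:
  "computable_nat f \<Longrightarrow> computable_nat g \<Longrightarrow> decidable (\<lambda>n. f n \<in> codes (g n))"
  unfolding in_codes_iff by (intro decidable_eq computable_code_length)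

section \<open>Plain complexity\<close>

lemma plain_C_le: "U p = Some \<sigma> \<Longrightarrow> plain_C U \<sigma> \<le> length p"
  unfolding plain_C_def by (intro wellorder_Inf_le1) blast

lemma machineI:
  assumes "partrec F"
  shows "machine (\<lambda>p. map_option str_decode (F (str_encode p)))"
  unfolding machine_def
  by (intro exI[of _ F] conjI assms allI) (simp add: option.map_comp comp_def option.map_ident)

text \<open>The invariance theorem transported along \<open>str_encode\<close>, so that descriptions
  can be built from functions on numbers.\<close>

lemma optimal_machine:
  assumes "optimal U" "partrec F"
  shows "\<exists>c. \<forall>p y. F (str_encode p) = Some y \<longrightarrow> plain_C U (str_decode y) \<le> length p + c"
proof -
  obtain c where c: "\<And>p \<sigma>. map_option str_decode (F (str_encode p)) = Some \<sigma> \<Longrightarrow>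
      \<exists>q. U q = Some \<sigma> \<and> length q \<le> length p + c"
    using assms(1) machineI[OF assms(2)] unfolding optimal_def by blast
  have "plain_C U (str_decode y) \<le> length p + c" if "F (str_encode p) = Some y" for p y
    using c[of p "str_decode y"] that plain_C_le by fastforce
  then show ?thesis by blast
qed

lemma plain_C_attained:
  assumes "optimal U"
  shows "\<exists>p. U p = Some \<sigma> \<and> length p = plain_C U \<sigma>"
proof -
  \<comment> \<open>The identity machine guarantees that every string has a description under
    \<open>U\<close>, so the infimum is attained.\<close>
  have "machine Some"
    unfolding machine_def using computable_id[unfolded computable_nat_def]
    by (intro exI[of _ Some]) simp
  then have "{length p | p. U p = Some \<sigma>} \<noteq> {}"
    using assms unfolding optimal_def by blast
  from Inf_nat_def1[OF this] show ?thesis unfolding plain_C_def by force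
qed

text \<open>An element of the \<open>n\<close>-th set is described by its rank in the order of enumeration, written
  with exactly \<open>n\<close> bits; the length of the description then reveals \<open>n\<close>.\<close>

lemma plain_C_enumerable:
  assumes U: "optimal U"
    and R: "decidable (\<lambda>p. R (pfst p) (pfst (psnd p)) (psnd (psnd p)))"
    and fin: "\<And>n. finite {x. \<exists>t. R n x t}"
    and card: "\<And>n. card {x. \<exists>t. R n x t} \<le> 2 ^ n"
  shows "\<exists>c. \<forall>n x t. R n (str_encode x) t \<longrightarrow> plain_C U x \<le> n + c"
proof -
  \<comment> \<open>A number \<open>w\<close> codes an element and a stage. Only the first pair for
    each element is \<open>new\<close>, so ranks count distinct elements.\<close>
  define new where "new n w \<longleftrightarrow> R n (pfst w) (psnd w) \<and>
    (\<forall>v<w. \<not> (R n (pfst v) (psnd v) \<and> pfst v = pfst w))" for n w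
  define rank where "rank n w = (\<Sum>v<w. of_bool (new n v) :: nat)" for n w
  \<comment> \<open>The code \<open>e\<close> of a description of length \<open>n\<close> has index
    \<open>Suc e - 2 ^ n\<close> among the codes for that length; this index is the rank to look
    for.\<close>
  define Q where "Q e w \<longleftrightarrow> new (code_length e) w \<and>
    rank (code_length e) w = Suc e - 2 ^ code_length e" for e w
  define F where "F e = (if \<exists>w. Q e w then Some (pfst (LEAST w. Q e w)) else None)" for e
  have R': "decidable (\<lambda>p. R (f p) (g p) (k p))"
    if "computable_nat f" "computable_nat g" "computable_nat k" for f g k
    using computable_comp[OF R[unfolded decidable_def]
        computable_prod_encode[OF that(1) computable_prod_encode[OF that(2,3)]]]
    by (simp add: decidable_def)
  have new: "decidable (\<lambda>p. new (f p) (g p))" if "computable_nat f" "computable_nat g" for f g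
    unfolding new_def
    by (intro computable_intros R' computable_comp[OF that(1)] computable_comp[OF that(2)])
  have "decidable (\<lambda>p. Q (pfst p) (psnd p))"
    unfolding Q_def rank_def
    by (intro computable_intros new computable_code_length)
  from partrec.comp[OF partrec.left partrec_search[OF this]]
  have "partrec F"
    by (rule arg_cong[where f = partrec, THEN iffD1, rotated]) (auto simp: F_def pfst_def)
  then obtain c where c: "\<And>p y. F (str_encode p) = Some y \<Longrightarrow>
      plain_C U (str_decode y) \<le> length p + c"
    using optimal_machine[OF U] by blast
  have "plain_C U x \<le> n + c" if Rx: "R n (str_encode x) t" for n x t
  proof -
    define w where "w = (LEAST w. R n (pfst w) (psnd w) \<and> pfst w = str_encode x)"
    have w: "R n (pfst w) (psnd w) \<and> pfst w = str_encode x" unfolding w_def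
      by (rule LeastI[of _ "prod_encode (str_encode x, t)"]) (simp add: Rx)
    have "new n w"
      using w not_less_Least[of _ "\<lambda>w. R n (pfst w) (psnd w) \<and> pfst w = str_encode x"]
      unfolding new_def by (auto simp: w_def[symmetric])
    have rank_less: "rank n u < rank n v" if "new n u" "u < v" for u v
    proof -
      have "rank n u < rank n (Suc u)" using that(1) by (simp add: rank_def)
      also have "\<dots> \<le> rank n v" unfolding rank_def using that(2) by (intro sum_mono2) auto
      finally show ?thesis .
    qed
    have "rank n w = card {v. v < w \<and> new n v}"
      unfolding rank_def by (simp add: Collect_conj_eq lessThan_def)
    also have "\<dots> = card (pfst ` {v. v < w \<and> new n v})"
      by (rule card_image[symmetric], rule linorder_inj_onI) (auto simp: new_def)
    \<comment> \<open>Strict, because \<open>str_encode x\<close> itself is not enumerated before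
      \<open>w\<close>. Hence the rank fits into \<open>n\<close> bits even if the set has
      \<open>2 ^ n\<close> elements.\<close>
    also have "\<dots> < card {x. \<exists>t. R n x t}"
    proof (rule psubset_card_mono[OF fin])
      have "str_encode x \<notin> pfst ` {v. v < w \<and> new n v}"
        using \<open>new n w\<close> w by (auto simp: new_def)
      then show "pfst ` {v. v < w \<and> new n v} \<subset> {x. \<exists>t. R n x t}"
        using Rx by (auto simp: new_def)
    qed
    finally have "rank n w < 2 ^ n" using card[of n] by simp
    define e where "e = 2 ^ n - 1 + rank n w"
    have e: "code_length e = n" "Suc e - 2 ^ n = rank n w"
      using codes_index[OF \<open>rank n w < 2 ^ n\<close>] code_length_eq by (simp_all add: e_def)
    \<comment> \<open>Ranks strictly increase along \<open>new\<close> pairs, so the search can only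
      stop at \<open>w\<close>.\<close>
    have "Q e v \<longleftrightarrow> v = w" for v
      using \<open>new n w\<close> rank_less[of v w] rank_less[of w v]
      by (cases v w rule: linorder_cases) (auto simp: Q_def e)
    then have "F e = Some (str_encode x)" using w Least_equality[of "Q e" w] by (simp add: F_def)
    then show ?thesis using c[of "str_decode e" "str_encode x"] by (simp add: e)
  qed
  then show ?thesis by blast
qed

section \<open>The extractor\<close>

text \<open>A number is read as an infinite list with head \<open>pfst\<close> and tail
  \<open>psnd\<close>. Any finite prefix can be prescribed, so finite functions can be searched for
  as numbers.\<close>

definition entry :: "nat \<Rightarrow> nat \<Rightarrow> nat" where
  "entry e j = pfst ((psnd ^^ j) e)"

lemma entry_surj: "\<exists>e. \<forall>j<m. entry e j = g j"
proof (induction m arbitrary: g)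
  case 0
  show ?case by simp
next
  case (Suc m)
  from Suc.IH[of "\<lambda>j. g (Suc j)"] obtain e where e: "\<forall>j<m. entry e j = g (Suc j)" ..
  have "entry (prod_encode (g 0, e)) j = g j" if "j < Suc m" for j
    using that e by (cases j) (auto simp: entry_def funpow_Suc_right simp del: funpow.simps)
  then show ?case by blast
qed

lemma computable_entry:
  assumes "computable_nat f" "computable_nat g"
  shows "computable_nat (\<lambda>n. entry (f n) (g n))"
  unfolding entry_def
  by (intro computable_pfst computable_funpow computable_psnd computable_id assms)

lemma set_encode_less:
  assumes "A \<subseteq> {..<m}"
  shows "set_encode A < 2 ^ m"
proof -
  have "set_encode A \<le> (\<Sum>i<m. 2 ^ i)"
    unfolding set_encode_def using assms by (intro sum_mono2) auto
  also have "\<dots> < 2 ^ m" by (induction m) auto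
  finally show ?thesis .
qed

text \<open>Reduction modulo \<open>2 ^ n\<close> makes every number \<open>e\<close> a legitimate
  table.\<close>

definition table_value :: "nat \<Rightarrow> nat \<Rightarrow> nat \<Rightarrow> nat \<Rightarrow> nat" where
  "table_value n e x a = entry e (prod_encode (x, a)) mod 2 ^ n"

text \<open>The condition \<open>k \<le> n - (l - n) / 2 ^ m - 3\<close>, cleared of denominators.\<close>

definition admissible :: "nat \<Rightarrow> nat \<Rightarrow> nat \<Rightarrow> nat \<Rightarrow> bool" where
  "admissible n l m k \<longleftrightarrow> k * 2 ^ m + (l - n) + 3 * 2 ^ m \<le> n * 2 ^ m"

text \<open>Sets of values are bit masks \<open>S\<close> and cardinalities are sums of truth
  values, so decidability follows from closure under bounded quantifiers and arithmetic.\<close>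

definition disperser :: "nat \<Rightarrow> nat \<Rightarrow> nat \<Rightarrow> nat \<Rightarrow> bool" where
  "disperser n l m e \<longleftrightarrow> (\<forall>S<2 ^ 2 ^ n :: nat. \<forall>k<Suc n.
     admissible n l m k \<longrightarrow> (\<Sum>j<2 ^ n. of_bool (S div 2 ^ j mod 2 = 1)) \<le> (2 ^ k :: nat) \<longrightarrow>
     (\<Sum>x<2 ^ Suc l. of_bool (x \<in> codes l \<and>
        (\<forall>a<2 ^ Suc m. a \<in> codes m \<longrightarrow> S div 2 ^ table_value n e x a mod 2 = 1))) < (2 ^ n :: nat))"

section \<open>Decidability and existence of disperser tables\<close>

lemma table_value_less: "table_value n e x a < 2 ^ n"
  by (simp add: table_value_def)

lemma computable_table_value:
  assumes "computable_nat n" "computable_nat e" "computable_nat x" "computable_nat a"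
  shows "computable_nat (\<lambda>i. table_value (n i) (e i) (x i) (a i))"
  unfolding table_value_def
  by (intro computable_mod computable_intros computable_entry assms) simp

lemma decidable_admissible:
  assumes "computable_nat n" "computable_nat l" "computable_nat m" "computable_nat k"
  shows "decidable (\<lambda>i. admissible (n i) (l i) (m i) (k i))"
  unfolding admissible_def by (intro computable_intros assms)

lemma decidable_bit:
  assumes "computable_nat s" "computable_nat j"
  shows "decidable (\<lambda>i. s i div 2 ^ j i mod 2 = 1)"
  by (intro computable_intros computable_mod computable_div assms) simp_all

lemma decidable_disperser:
  assumes "computable_nat n" "computable_nat l" "computable_nat m" "computable_nat e"
  shows "decidable (\<lambda>i. disperser (n i) (l i) (m i) (e i))"
  unfolding disperser_def
  by (intro decidable_bit computable_intros decidable_admissible decidable_in_codes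
      computable_table_value assms[THEN computable_comp])

lemma admissible_le: "admissible n l m k \<Longrightarrow> k \<le> n"
  unfolding admissible_def by (metis add_leD1 mult_le_cancel2 zero_less_numeral zero_less_power)

lemma bit_iff_set_decode: "S div 2 ^ j mod 2 = 1 \<longleftrightarrow> j \<in> set_decode S"
  by (simp add: set_decode_def odd_iff_mod_2_eq_one)

text \<open>The numerical bounds are exhaustive: bit masks below \<open>2 ^ 2 ^ n\<close> give all
  subsets of \<open>{..<2 ^ n}\<close>, codes for length \<open>l\<close> lie below
  \<open>2 ^ Suc l\<close>, and an admissible \<open>k\<close> is at most \<open>n\<close>.\<close>

lemma disperser_iff:
  "disperser n l m e \<longleftrightarrow> (\<forall>S k. S \<subseteq> {..<2 ^ n} \<longrightarrow> admissible n l m k \<longrightarrow> card S \<le> 2 ^ k \<longrightarrow>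
     card {x \<in> codes l. \<forall>a\<in>codes m. table_value n e x a \<in> S} < 2 ^ n)"
proof -
  have card: "(\<Sum>j<2 ^ n. of_bool (S div 2 ^ j mod 2 = 1)) = card ({..<2 ^ n} \<inter> set_decode S)"
    for S :: nat
    unfolding bit_iff_set_decode by simp
  have card_bad: "(\<Sum>x<2 ^ Suc l. of_bool (x \<in> codes l \<and>
        (\<forall>a<2 ^ Suc m. a \<in> codes m \<longrightarrow> S div 2 ^ table_value n e x a mod 2 = 1)))
      = card {x \<in> codes l. \<forall>a\<in>codes m. table_value n e x a \<in> {..<2 ^ n} \<inter> set_decode S}" for S
  proof -
    have "{x \<in> codes l. \<forall>a\<in>codes m. table_value n e x a \<in> {..<2 ^ n} \<inter> set_decode S}
        = {..<2 ^ Suc l} \<inter> {x. x \<in> codes l \<and>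
        (\<forall>a<2 ^ Suc m. a \<in> codes m \<longrightarrow> S div 2 ^ table_value n e x a mod 2 = 1)}"
      unfolding bit_iff_set_decode using codes_less table_value_less by blast
    then show ?thesis by simp
  qed
  have sets: "(\<forall>S<2 ^ 2 ^ n. P ({..<2 ^ n} \<inter> set_decode S)) \<longleftrightarrow> (\<forall>S\<subseteq>{..<2 ^ n}. P S)" for P
  proof (intro iffI allI impI)
    fix S :: "nat set" assume P: "\<forall>S<2 ^ 2 ^ n. P ({..<2 ^ n} \<inter> set_decode S)" and S: "S \<subseteq> {..<2 ^ n}"
    then have "P ({..<2 ^ n} \<inter> set_decode (set_encode S))" using set_encode_less by blast
    moreover have "finite S" using S finite_subset by blast
    ultimately show "P S" using S by (simp add: Int_absorb1)
  next
    fix S :: nat assume "\<forall>S\<subseteq>{..<2 ^ n}. P S"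
    then show "P ({..<2 ^ n} \<inter> set_decode S)" by (metis Int_lower1)
  qed
  have lt: "admissible n l m k \<Longrightarrow> k < Suc n" for k
    by (simp add: admissible_le less_Suc_eq_le)
  let ?P = "\<lambda>S. \<forall>k<Suc n. admissible n l m k \<longrightarrow> card S \<le> 2 ^ k \<longrightarrow>
    card {x \<in> codes l. \<forall>a\<in>codes m. table_value n e x a \<in> S} < 2 ^ n"
  have "disperser n l m e \<longleftrightarrow> (\<forall>S<2 ^ 2 ^ n. ?P ({..<2 ^ n} \<inter> set_decode S))"
    unfolding disperser_def card card_bad by (rule refl)
  also have "\<dots> \<longleftrightarrow> (\<forall>S\<subseteq>{..<2 ^ n}. ?P S)" by (rule sets)
  finally show ?thesis using lt by blast
qed

lemma disperser_table_exists:
  assumes "n \<le> l"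
  shows "\<exists>e. disperser n l m e"
proof -
  obtain g :: "nat \<Rightarrow> nat \<Rightarrow> nat" where g: "\<forall>x\<in>codes l. \<forall>a\<in>codes m. g x a < 2 ^ n"
    and disp: "\<And>S k. S \<subseteq> {..<2 ^ n} \<Longrightarrow> card S \<le> 2 ^ k \<Longrightarrow> admissible n l m k \<Longrightarrow>
      card {x\<in>codes l. \<forall>a\<in>codes m. g x a \<in> S} < 2 ^ n"
    using disperser_exists[OF card_codes finite_codes codes_nonempty assms, of m]
    unfolding card_codes admissible_def by blast
  let ?I = "prod_encode ` (codes l \<times> codes m)"
  have "finite ?I" by (simp add: finite_codes)
  then obtain b where b: "\<And>j. j \<in> ?I \<Longrightarrow> j < b"
    by (meson finite_nat_set_iff_bounded)
  obtain e where e: "\<forall>j<b. entry e j = g (pfst j) (psnd j)"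
    using entry_surj[of b "\<lambda>j. g (pfst j) (psnd j)"] by blast
  have "table_value n e x a = g x a" if "x \<in> codes l" "a \<in> codes m" for x a
    using that e b[of "prod_encode (x, a)"] g by (simp add: table_value_def)
  then have "{x\<in>codes l. \<forall>a\<in>codes m. table_value n e x a \<in> S}
    = {x\<in>codes l. \<forall>a\<in>codes m. g x a \<in> S}" for S by auto
  then show ?thesis using disp unfolding disperser_iff by (intro exI[of _ e]) auto
qed

section \<open>The extractor with \<open>n\<close> as an extra argument\<close>

lemma extractor_with_length:
  assumes U: "optimal U" and f: "computable_nat f" and h: "computable_nat h"
    and fn: "\<And>n. f n \<ge> n"
  shows "\<exists>(E :: nat \<Rightarrow> str \<Rightarrow> str \<Rightarrow> str) (d :: nat). computable_nat_str2 E \<and>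
        (\<forall>n.
          (\<forall>x a. length x = f n \<and> length a = h n \<longrightarrow> length (E n x a) = n) \<and>
          (\<forall>x. length x = f n \<and> plain_C U x \<ge> n + d \<longrightarrow>
            (\<exists>a. length a = h n \<and>
              real (plain_C U (E n x a)) \<ge> real n - (real (f n) - real n) / 2 ^ h n - real d)))"
proof -
  note cf = computable_comp[OF f] and ch = computable_comp[OF h]
  obtain V H where V: "\<And>p. V (str_encode p) = map_option str_encode (U p)" and H: "simulates H V"
    using U partrec_simulates unfolding optimal_def machine_def by metis
  define tab where "tab n = (LEAST e. disperser n (f n) (h n) e)" for n
  \<comment> \<open>The offset turns a table value into the code of a string of length exactly
    \<open>n\<close>.\<close>
  define val where "val n x a = 2 ^ n - 1 + table_value n (tab n) x a" for n x a
  define E where "E n x a = str_decode (val n (str_encode x) (str_encode a))" for n x a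
  have tab: "computable_nat tab"
    unfolding tab_def using disperser_table_exists[OF fn]
    by (intro computable_Least decidable_disperser computable_intros cf ch)
  have val: "computable_nat (\<lambda>i. val (n i) (x i) (a i))"
    if "computable_nat n" "computable_nat x" "computable_nat a" for n x a
    unfolding val_def
    by (intro computable_intros computable_table_value computable_comp[OF tab] that)
  have val_codes: "val n x a \<in> codes n" for n x a
    unfolding val_def by (rule codes_index[OF table_value_less])
  have comp_E: "computable_nat_str2 E"
    unfolding computable_nat_str2_def
  proof (intro exI conjI allI)
    show "partrec (\<lambda>i. Some (val (pfst i) (pfst (psnd i)) (psnd (psnd i))))"
      unfolding computable_nat_def[symmetric] by (intro val computable_intros)
  qed (simp add: E_def)
  \<comment> \<open>At stage \<open>t\<close> every image of \<open>x\<close> has been seen to be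
    the output of a short program. The bound on \<open>q\<close> keeps the search finite and covers
    all such programs, whose lengths are below \<open>n\<close>.\<close>
  define R where "R n x t \<longleftrightarrow> x \<in> codes (f n) \<and> (\<forall>a<2 ^ Suc (h n). a \<in> codes (h n) \<longrightarrow>
    (\<exists>q<2 ^ Suc n. admissible n (f n) (h n) (Suc (code_length q)) \<and> H q t = Suc (val n x a)))"
    for n x t
  have dec_R: "decidable (\<lambda>p. R (pfst p) (pfst (psnd p)) (psnd (psnd p)))"
    unfolding R_def
    by (intro computable_intros decidable_in_codes decidable_admissible computable_code_length
        simulates_apply[OF H] val cf ch)
  have bad: "finite {x. \<exists>t. R n x t} \<and> card {x. \<exists>t. R n x t} \<le> 2 ^ n" for n
  \<comment> \<open>It may be that no program length qualifies, not even 0; as there is at least one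
    seed, nothing is then enumerated.\<close>
  proof (cases "\<exists>q. admissible n (f n) (h n) (Suc (code_length q))")
    case False
    then have "{x. \<exists>t. R n x t} = {}" using codes_nonempty[of "h n"] codes_less
      unfolding R_def by fastforce
    then show ?thesis by simp
  next
    case True
    let ?P = "\<lambda>k. \<exists>q. code_length q = k \<and> admissible n (f n) (h n) (Suc k)"
    have bound: "\<And>k. ?P k \<Longrightarrow> k \<le> n" using admissible_le Suc_leD by blast
    \<comment> \<open>The largest qualifying program length. There are fewer than
      \<open>2 ^ Suc k\<close> programs of length at most \<open>k\<close>, hence the
      \<open>Suc\<close> in the admissibility condition.\<close>
    define k where "k = (GREATEST k. ?P k)"
    have k: "admissible n (f n) (h n) (Suc k)"
      using True GreatestI_ex_nat[of ?P, OF _ bound] unfolding k_def by blast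
    have le_k: "code_length q \<le> k" if "admissible n (f n) (h n) (Suc (code_length q))" for q
      unfolding k_def using that by (intro Greatest_le_nat[of ?P, OF _ bound]) auto
    \<comment> \<open>The positions, among the strings of length \<open>n\<close>, of outputs of
      short programs. No stage occurs, so one \<open>S\<close> serves for all
      \<open>t\<close>.\<close>
    define S where "S = {v. v < 2 ^ n \<and>
      (\<exists>q. admissible n (f n) (h n) (Suc (code_length q)) \<and> V q = Some (2 ^ n - 1 + v))}"
    have "S \<subseteq> (\<lambda>q. the (V q) - (2 ^ n - 1)) ` {..<2 ^ Suc k}"
    proof
      fix v assume "v \<in> S"
      then obtain q where q: "admissible n (f n) (h n) (Suc (code_length q))"
        "V q = Some (2 ^ n - 1 + v)" by (auto simp: S_def)
      have "q < 2 ^ Suc (code_length q)" using codes_less in_codes_iff by blast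
      also have "\<dots> \<le> 2 ^ Suc k" using le_k[OF q(1)] by (intro power_increasing) auto
      finally show "v \<in> (\<lambda>q. the (V q) - (2 ^ n - 1)) ` {..<2 ^ Suc k}"
        using q(2) by (intro image_eqI[of _ _ q]) auto
    qed
    then have "card S \<le> card {..<(2 :: nat) ^ Suc k}" using surj_card_le by blast
    then have "card S \<le> 2 ^ Suc k" by simp
    moreover have "S \<subseteq> {..<2 ^ n}" by (auto simp: S_def)
    moreover have "disperser n (f n) (h n) (tab n)"
      unfolding tab_def using disperser_table_exists[OF fn] by (rule LeastI_ex)
    ultimately have "card {x \<in> codes (f n). \<forall>a\<in>codes (h n). table_value n (tab n) x a \<in> S} < 2 ^ n"
      using k unfolding disperser_iff by blast
    moreover have "{x. \<exists>t. R n x t}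
        \<subseteq> {x \<in> codes (f n). \<forall>a\<in>codes (h n). table_value n (tab n) x a \<in> S}"
      unfolding R_def S_def val_def
      using codes_less table_value_less simulates_sound[OF H] by fast
    moreover have "finite {x \<in> codes (f n). \<forall>a\<in>codes (h n). table_value n (tab n) x a \<in> S}"
      by (simp add: finite_codes)
    ultimately show ?thesis by (meson card_mono finite_subset le_less_trans less_imp_le)
  qed
  obtain c where c: "\<And>n x t. R n (str_encode x) t \<Longrightarrow> plain_C U x \<le> n + c"
    using plain_C_enumerable[OF U dec_R] bad by blast
  \<comment> \<open>The \<open>c\<close> is the cost of describing \<open>x\<close> by its rank; the
    4 is the 3 of the disperser bound plus 1 for the \<open>Suc\<close> of the program
    length.\<close>
  define d where "d = c + 4"
  have len: "length (E n x a) = n" for n x a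
    unfolding E_def length_str_decode by (rule code_length_eq[OF val_codes])
  have "\<exists>a. length a = h n \<and>
      real (plain_C U (E n x a)) \<ge> real n - (real (f n) - real n) / 2 ^ h n - real d"
    if x: "length x = f n" "plain_C U x \<ge> n + d" for n x
  proof (rule ccontr)
    assume no: "\<not> ?thesis"
    have q: "\<exists>q. admissible n (f n) (h n) (Suc (code_length q))
        \<and> V q = Some (val n (str_encode x) a)" if a: "a \<in> codes (h n)" for a
    proof -
      obtain p where p: "U p = Some (E n x (str_decode a))"
          "length p = plain_C U (E n x (str_decode a))"
        using plain_C_attained[OF U] by blast
      have "length (str_decode a) = h n" using a by (simp add: in_codes_iff)
      then have "real (length p) < real n - (real (f n) - real n) / 2 ^ h n - real d"
        using no p(2) by (auto simp: not_le)
      then have "real (length p) * 2 ^ h n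
          < (real n - (real (f n) - real n) / 2 ^ h n - real d) * 2 ^ h n"
        by (rule mult_strict_right_mono) simp
      also have "\<dots> = real n * 2 ^ h n - (real (f n) - real n) - real d * 2 ^ h n"
        by (simp add: field_simps)
      also have "\<dots> \<le> real n * 2 ^ h n - (real (f n) - real n) - 4 * 2 ^ h n"
        by (intro diff_left_mono mult_right_mono) (simp_all add: d_def)
      finally have "real (Suc (length p) * 2 ^ h n + (f n - n) + 3 * 2 ^ h n) \<le> real (n * 2 ^ h n)"
        using fn[of n] by (simp add: of_nat_diff algebra_simps)
      then have "admissible n (f n) (h n) (Suc (code_length (str_encode p)))"
        unfolding of_nat_le_iff by (simp add: admissible_def)
      moreover have "V (str_encode p) = Some (val n (str_encode x) a)"
        using p(1) V by (simp add: E_def)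
      ultimately show ?thesis by blast
    qed
    then obtain Q where Q: "\<And>a. a \<in> codes (h n) \<Longrightarrow>
        admissible n (f n) (h n) (Suc (code_length (Q a)))"
      and VQ: "\<And>a. a \<in> codes (h n) \<Longrightarrow> V (Q a) = Some (val n (str_encode x) a)"
      by metis
    \<comment> \<open>There are finitely many seeds, so one stage shows the short programs for all
      of them and \<open>x\<close> is enumerated, contrary to its high complexity.\<close>
    obtain t where t: "\<forall>a\<in>codes (h n). H (Q a) t = Suc (val n (str_encode x) a)"
      using simulates_complete_uniform[OF H finite_codes, of "h n" Q] VQ by blast
    have "Q a < 2 ^ Suc n" if "a \<in> codes (h n)" for a
    proof -
      have "Q a < 2 ^ Suc (code_length (Q a))" using codes_less in_codes_iff by blast
      also have "\<dots> \<le> 2 ^ Suc n"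
        using admissible_le[OF Q[OF that]] by (intro power_increasing) auto
      finally show ?thesis .
    qed
    then have "R n (str_encode x) t"
      unfolding R_def using Q t str_encode_in_codes[of x] x(1) by metis
    from c[OF this] x(2) show False by (simp add: d_def)
  qed
  with comp_E len show ?thesis by blast
qed

section \<open>Recovering \<open>n\<close> from the two lengths\<close>

lemma computable_str2_of_computable_nat_str2:
  assumes E: "computable_nat_str2 E" and N: "computable_nat (\<lambda>p. N (pfst p) (psnd p))"
  shows "computable_str2 (\<lambda>x a. E (N (length x) (length a)) x a)"
proof -
  obtain F where F: "partrec F" "\<And>n x a. F (prod_encode (n, prod_encode (str_encode x, str_encode a)))
        = Some (str_encode (E n x a))"
    using E unfolding computable_nat_str2_def by blast
  let ?G = "\<lambda>i. prod_encode (N (code_length (pfst i)) (code_length (psnd i)), i)"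
  have "computable_nat (\<lambda>i. N (code_length (pfst i)) (code_length (psnd i)))"
    using computable_comp[OF N, of "\<lambda>i. prod_encode (code_length (pfst i), code_length (psnd i))"]
    by (simp add: computable_code_length computable_intros)
  then have "computable_nat ?G" by (intro computable_intros)
  from partrec.comp[OF F(1) this[unfolded computable_nat_def]]
  have "partrec (\<lambda>i. F (?G i))" by simp
  then show ?thesis unfolding computable_str2_def
    by (intro exI[of _ "\<lambda>i. F (?G i)"]) (simp add: F(2))
qed

text \<open>Two different \<open>n\<close> with the same \<open>f n\<close> and \<open>h n\<close>
  would demand two different lengths of one string \<open>E x a\<close>. Hence the two-argument
  \<open>E\<close> is claimed when the pair of lengths determines \<open>n\<close>, and in general
  \<open>E\<close> also receives \<open>n\<close>.\<close>

theorem theorem34: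
  fixes f h :: "nat \<Rightarrow> nat" and U :: "str \<Rightarrow> str option"
  assumes "optimal U"
    and "computable_nat f" and "computable_nat h"
    and "\<And>n. f n \<ge> n"
  shows "(inj (\<lambda>n. (f n, h n)) \<longrightarrow>
      (\<exists>(E :: str \<Rightarrow> str \<Rightarrow> str) (d :: nat). computable_str2 E \<and>
        (\<forall>n.
          (\<forall>x a. length x = f n \<and> length a = h n \<longrightarrow> length (E x a) = n) \<and>
          (\<forall>x. length x = f n \<and> plain_C U x \<ge> n + d \<longrightarrow>
            (\<exists>a. length a = h n \<and>
              real (plain_C U (E x a)) \<ge> real n - (real (f n) - real n) / 2 ^ h n - real d)))))
    \<and> (\<exists>(E :: nat \<Rightarrow> str \<Rightarrow> str \<Rightarrow> str) (d :: nat). computable_nat_str2 E \<and>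
        (\<forall>n.
          (\<forall>x a. length x = f n \<and> length a = h n \<longrightarrow> length (E n x a) = n) \<and>
          (\<forall>x. length x = f n \<and> plain_C U x \<ge> n + d \<longrightarrow>
            (\<exists>a. length a = h n \<and>
              real (plain_C U (E n x a)) \<ge> real n - (real (f n) - real n) / 2 ^ h n - real d))))"
proof -
  obtain E :: "nat \<Rightarrow> str \<Rightarrow> str \<Rightarrow> str" and d :: nat where E: "computable_nat_str2 E"
    and len: "\<And>n x a. length x = f n \<Longrightarrow> length a = h n \<Longrightarrow> length (E n x a) = n"
    and compl: "\<And>n x. length x = f n \<Longrightarrow> plain_C U x \<ge> n + d \<Longrightarrow> \<exists>a. length a = h n \<and>
        real (plain_C U (E n x a)) \<ge> real n - (real (f n) - real n) / 2 ^ h n - real d"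
    using extractor_with_length[OF assms] by metis
  \<comment> \<open>Since \<open>n \<le> f n\<close>, the search for the \<open>n\<close> belonging to the lengths \<open>(l, m)\<close> may stop after \<open>l\<close>.\<close>
  define N where "N l m = (LEAST n. l < n \<or> f n = l \<and> h n = m)" for l m
  have "computable_nat (\<lambda>p. N (pfst p) (psnd p))" unfolding N_def
    by (intro computable_Least computable_intros computable_comp[OF assms(2)]
        computable_comp[OF assms(3)]) blast
  from computable_str2_of_computable_nat_str2[OF E this]
  have E': "computable_str2 (\<lambda>x a. E (N (length x) (length a)) x a)" .
  have N: "N (f n) (h n) = n" if "inj (\<lambda>n. (f n, h n))" for n
    unfolding N_def
  proof (rule Least_equality)
    show "n \<le> k" if "f n < k \<or> f k = f n \<and> h k = h n" for k
      using that assms(4)[of n] injD[OF \<open>inj (\<lambda>n. (f n, h n))\<close>, of k n] by auto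
  qed simp
  show ?thesis
  proof (intro conjI impI)
    assume inj: "inj (\<lambda>n. (f n, h n))"
    show "\<exists>(E :: str \<Rightarrow> str \<Rightarrow> str) (d :: nat). computable_str2 E \<and>
        (\<forall>n.
          (\<forall>x a. length x = f n \<and> length a = h n \<longrightarrow> length (E x a) = n) \<and>
          (\<forall>x. length x = f n \<and> plain_C U x \<ge> n + d \<longrightarrow>
            (\<exists>a. length a = h n \<and>
              real (plain_C U (E x a)) \<ge> real n - (real (f n) - real n) / 2 ^ h n - real d)))"
    proof (intro exI[of _ "\<lambda>x a. E (N (length x) (length a)) x a"] exI[of _ d] conjI allI impI E')
      fix n x assume x: "length x = f n \<and> n + d \<le> plain_C U x"
      then obtain a where a: "length a = h n"
        "real (plain_C U (E n x a)) \<ge> real n - (real (f n) - real n) / 2 ^ h n - real d"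
        using compl by blast
      then show "\<exists>a. length a = h n \<and> real (plain_C U (E (N (length x) (length a)) x a))
          \<ge> real n - (real (f n) - real n) / 2 ^ h n - real d"
        using x N[OF inj] by auto
    qed (use len N[OF inj] in auto)
  qed (use E len compl in blast)
qed

end
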